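(* Let $M$ be a compact metric space and $f:M\to M$ a homeomorphism such that the non-wandering set $\Omega(f)$ is finite. Then $$o(f)=\sup\{[c_{f,\mathcal F}(n)]\in\mathbb O:\ \mathcal F\in\Sigma\}.$$ In addition, for every $\delta>0$ the same equality holds with $\Sigma$ replaced by $\Sigma_\delta$.
   Context: Orders of growth: $\mathbb N=\{1,2,\dots\}$ and $\mathcal O$ is the set of non-decreasing sequences $a:\mathbb N\to[0,\infty)$. Write $a\approx b$ if there are $c_1,c_2\in(0,\infty)$ with $c_1a(n)\le b(n)\le c_2a(n)$ for all $n$; $\mathbb O=\mathcal O/_{\approx}$, and $[a(n)]$ is the class of $a$. Partial order: $[a(n)]\le[b(n)]$ if there is $C>0$ with $a(n)\le Cb(n)$ for all $n$. $\overline{\mathbb O}\supset\mathbb O$ is the Dedekind-MacNeille completion of $\mathbb O$; suprema are taken in $\overline{\mathbb O}$. Generalized entropy: with $d^f_n(x,y)=\max_{0\le k\le n-1}d(f^k(x),f^k(y))$ and $B(x,n,\varepsilon)=\{y: d^f_n(x,y)<\varepsilon\}$, let $g_{f,\varepsilon}(n)$ be the minimal cardinality of a finite set $F\subset M$ with $M=\bigcup_{x\in F}B(x,n,\varepsilon)$. Then $o(f)=\sup\{[g_{f,\varepsilon}(n)]:\varepsilon>0\}\in\overline{\mathbb O}$. Codings: let $\mathcal F$ be a finite family of non-empty subsets of $M\setminus\Omega(f)$, and let $\infty_{\mathcal F}=M\setminus\bigcup\mathcal F$. A word $(w_0,\dots,w_{n-1})$ with letters in $\mathcal F\cup\{\infty_{\mathcal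 F}\}$ is a coding of $(x_0,\dots,x_{n-1})\in M^n$ if $x_i\in w_i$ for all $i$ (a sequence can have several codings). $\mathcal A_n(f,\mathcal F)$ is the set of all codings of all orbit segments $(x,f(x),\dots,f^{n-1}(x))$, $x\in M$, and $c_{f,\mathcal F}(n)=\#\mathcal A_n(f,\mathcal F)$. A set $Y$ is wandering if $f^n(Y)\cap Y=\emptyset$ for every $n\ge1$. A compact neighborhood is a compact set that is the closure of an open set. Subsets $Y_1,\dots,Y_L$ of $M\setminus\Omega(f)$ are mutually singular if for every $N>0$ there exist a point $x$ and times $n_1,\dots,n_L$ such that $f^{n_i}(x)\in Y_i$ for every $i$ and $|n_i-n_j|>N$ for every $i\ne j$. $\Sigma$ is the collection of all finite families of wandering compact neighborhoods in $M\setminus\Omega(f)$ that are mutually singular; $\Sigma_\delta$ is the subcollection of the families all of whose elements have diameter smaller than $\delta$. *)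

theory Defs
  imports "HOL-Analysis.Analysis"
begin

section \<open>Orders of growth\<close>

text \<open>Sequences are indexed by the positive integers: the value at index 0 is never used.\<close>

definition is_growth :: "(nat \<Rightarrow> real) \<Rightarrow> bool" where
  "is_growth a \<longleftrightarrow> mono_on {1..} a \<and> (\<forall>n\<ge>1. 0 \<le> a n)"

definition growth_equiv :: "(nat \<Rightarrow> real) \<Rightarrow> (nat \<Rightarrow> real) \<Rightarrow> bool" where
  "growth_equiv a b \<longleftrightarrow> is_growth a \<and> is_growth b \<and>
     (\<exists>c1>0. \<exists>c2>0. \<forall>n\<ge>1. c1 * a n \<le> b n \<and> b n \<le> c2 * a n)"

definition growth_le :: "(nat \<Rightarrow> real) \<Rightarrow> (nat \<Rightarrow> real) \<Rightarrow> bool" where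
  "growth_le a b \<longleftrightarrow> (\<exists>C>0. \<forall>n\<ge>1. a n \<le> C * b n)"

lemma growth_le_refl: "growth_le a a"
  unfolding growth_le_def by (intro exI[of _ 1]) auto

lemma growth_le_trans:
  assumes "growth_le a b" "growth_le b c"
  shows "growth_le a c"
proof -
  obtain C D where C: "C > 0" "\<forall>n\<ge>1. a n \<le> C * b n" and D: "D > 0" "\<forall>n\<ge>1. b n \<le> D * c n"
    using assms unfolding growth_le_def by blast
  have "a n \<le> (C * D) * c n" if "n \<ge> 1" for n
  proof -
    have "a n \<le> C * b n" using C that by blast
    also have "\<dots> \<le> C * (D * c n)" using C D that by (intro mult_left_mono) auto
    finally show ?thesis by (simp add: mult.assoc)
  qed
  then show ?thesis using C D unfolding growth_le_def by (intro exI[of _ "C * D"]) auto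
qed

lemma growth_equiv_iff:
  "growth_equiv a b \<longleftrightarrow> is_growth a \<and> is_growth b \<and> growth_le a b \<and> growth_le b a"
proof
  assume "growth_equiv a b"
  then obtain c1 c2 where g: "is_growth a" "is_growth b" and c: "c1 > 0" "c2 > 0"
    and le: "\<forall>n\<ge>1. c1 * a n \<le> b n \<and> b n \<le> c2 * a n"
    unfolding growth_equiv_def by blast
  have "growth_le a b"
    unfolding growth_le_def using c le
    by (intro exI[of _ "inverse c1"]) (auto simp: field_simps)
  moreover have "growth_le b a"
    unfolding growth_le_def using c le by blast
  ultimately show "is_growth a \<and> is_growth b \<and> growth_le a b \<and> growth_le b a"
    using g by blast
next
  assume r: "is_growth a \<and> is_growth b \<and> growth_le a b \<and> growth_le b a"
  then obtain C D where C: "C > 0" "\<forall>n\<ge>1. a n \<le> C * b n" and D: "D > 0" "\<forall>n\<ge>1. b n \<le> D * a n"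
    unfolding growth_le_def by blast
  have "inverse C > 0" "\<forall>n\<ge>1. inverse C * a n \<le> b n"
    using C by (auto simp: field_simps)
  then show "growth_equiv a b"
    unfolding growth_equiv_def using r D by blast
qed

quotient_type growth = "nat \<Rightarrow> real" / partial: growth_equiv
  morphisms rep_growth growth_class
proof (rule part_equivpI)
  have "is_growth (\<lambda>_. 0)" by (auto simp: is_growth_def mono_on_def)
  then show "\<exists>a. growth_equiv a a"
    using growth_le_refl by (auto simp: growth_equiv_iff)
  show "symp growth_equiv" by (auto simp: symp_def growth_equiv_iff)
  show "transp growth_equiv"
    unfolding transp_def growth_equiv_iff using growth_le_trans by blast
qed

instantiation growth :: order
begin

lift_definition less_eq_growth :: "growth \<Rightarrow> growth \<Rightarrow> bool" is growth_le
  unfolding growth_equiv_iff using growth_le_trans by blast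

definition less_growth :: "growth \<Rightarrow> growth \<Rightarrow> bool" where
  "less_growth x y \<longleftrightarrow> x \<le> y \<and> \<not> y \<le> x"

instance
proof
  fix x y z :: growth
  show "x < y \<longleftrightarrow> x \<le> y \<and> \<not> y \<le> x" by (rule less_growth_def)
  show "x \<le> x" by transfer (rule growth_le_refl)
  show "x \<le> y \<Longrightarrow> y \<le> z \<Longrightarrow> x \<le> z" by transfer (rule growth_le_trans)
  show "x \<le> y \<Longrightarrow> y \<le> x \<Longrightarrow> x = y" by transfer (auto simp: growth_equiv_iff)
qed

end

lemma growth_class_le_iff:
  assumes "is_growth a" "is_growth b"
  shows "growth_class a \<le> growth_class b \<longleftrightarrow> growth_le a b"
  using assms by (simp add: less_eq_growth.abs_eq growth_equiv_iff growth_le_refl)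

lemma growth_class_eq_iff:
  assumes "is_growth a" "is_growth b"
  shows "growth_class a = growth_class b \<longleftrightarrow> growth_equiv a b"
  using assms by (auto simp: order_eq_iff growth_class_le_iff growth_equiv_iff)


section \<open>The Dedekind-MacNeille completion of a partial order\<close>

definition upper_bounds :: "'a::order set \<Rightarrow> 'a set" where
  "upper_bounds A = {u. \<forall>a\<in>A. a \<le> u}"

definition lower_bounds :: "'a::order set \<Rightarrow> 'a set" where
  "lower_bounds A = {l. \<forall>a\<in>A. l \<le> a}"

lemma bounds_galois: "A \<subseteq> lower_bounds B \<longleftrightarrow> B \<subseteq> upper_bounds A"
  by (auto simp: upper_bounds_def lower_bounds_def)

lemma lower_upper_extensive: "A \<subseteq> lower_bounds (upper_bounds A)"
  by (simp add: bounds_galois)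

lemma lower_bounds_antimono: "A \<subseteq> B \<Longrightarrow> lower_bounds B \<subseteq> lower_bounds A"
  by (auto simp: lower_bounds_def)

lemma upper_bounds_antimono: "A \<subseteq> B \<Longrightarrow> upper_bounds B \<subseteq> upper_bounds A"
  by (auto simp: upper_bounds_def)

lemma lower_upper_lower: "lower_bounds (upper_bounds (lower_bounds A)) = lower_bounds A"
  using lower_upper_extensive[of "lower_bounds A"] bounds_galois[of "lower_bounds A" A]
    lower_bounds_antimono[of A "upper_bounds (lower_bounds A)"]
  by blast

lemma lower_upper_mono:
  "A \<subseteq> B \<Longrightarrow> lower_bounds (upper_bounds A) \<subseteq> lower_bounds (upper_bounds B)"
  by (intro lower_bounds_antimono upper_bounds_antimono)

typedef (overloaded) 'a completion = "{A :: 'a::order set. lower_bounds (upper_bounds A) = A}"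
  morphisms cut Abs_completion
  by (intro exI[of _ "lower_bounds (upper_bounds {})"]) (simp add: lower_upper_lower)

setup_lifting type_definition_completion

lift_definition embed :: "'a::order \<Rightarrow> 'a completion" is "\<lambda>a. {..a}"
proof -
  fix a :: 'a
  show "lower_bounds (upper_bounds {..a}) = {..a}"
    by (auto simp: lower_bounds_def upper_bounds_def intro: order_trans)
qed

lemma cut_Inter_closed:
  assumes "\<And>A. A \<in> \<A> \<Longrightarrow> lower_bounds (upper_bounds A) = A"
  shows "lower_bounds (upper_bounds (\<Inter>\<A>)) = \<Inter>\<A>"
proof
  show "lower_bounds (upper_bounds (\<Inter>\<A>)) \<subseteq> \<Inter>\<A>"
    using assms lower_upper_mono[of "\<Inter>\<A>"] by blast
qed (rule lower_upper_extensive)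

instantiation completion :: (order) complete_lattice
begin

lift_definition less_eq_completion :: "'a completion \<Rightarrow> 'a completion \<Rightarrow> bool" is "(\<subseteq>)" .

lift_definition less_completion :: "'a completion \<Rightarrow> 'a completion \<Rightarrow> bool" is "(\<subset>)" .

lift_definition Sup_completion :: "'a completion set \<Rightarrow> 'a completion"
  is "\<lambda>\<A>. lower_bounds (upper_bounds (\<Union>\<A>))"
  by (rule lower_upper_lower)

lift_definition Inf_completion :: "'a completion set \<Rightarrow> 'a completion"
  is "\<lambda>\<A>. \<Inter>\<A>"
  by (rule cut_Inter_closed)

definition "sup_completion (x :: 'a completion) y = Sup {x, y}"
definition "inf_completion (x :: 'a completion) y = Inf {x, y}"
definition "bot_completion = (Sup {} :: 'a completion)"
definition "top_completion = (Inf {} :: 'a completion)"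

instance
proof -
  have Sup_upper: "x \<le> Sup A" if "x \<in> A" for x :: "'a completion" and A
    using that lower_upper_extensive[of "\<Union>(cut ` A)"]
    by (auto simp: less_eq_completion.rep_eq Sup_completion.rep_eq)
  have Sup_least: "Sup A \<le> z" if "\<And>x. x \<in> A \<Longrightarrow> x \<le> z" for z :: "'a completion" and A
  proof -
    have "\<Union>(cut ` A) \<subseteq> cut z"
      using that by (auto simp: less_eq_completion.rep_eq)
    then have "lower_bounds (upper_bounds (\<Union>(cut ` A))) \<subseteq> lower_bounds (upper_bounds (cut z))"
      by (rule lower_upper_mono)
    then show ?thesis
      using cut[of z] by (simp add: less_eq_completion.rep_eq Sup_completion.rep_eq)
  qed
  have Inf_lower: "Inf A \<le> x" if "x \<in> A" for x :: "'a completion" and A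
    using that by (auto simp: less_eq_completion.rep_eq Inf_completion.rep_eq)
  have Inf_greatest: "z \<le> Inf A" if "\<And>x. x \<in> A \<Longrightarrow> z \<le> x" for z :: "'a completion" and A
    using that by (auto simp: less_eq_completion.rep_eq Inf_completion.rep_eq)
  show "OFCLASS('a completion, complete_lattice_class)"
  proof
    fix x y z :: "'a completion" and A :: "'a completion set"
    show "x < y \<longleftrightarrow> x \<le> y \<and> \<not> y \<le> x" by transfer blast
    show "x \<le> x" by transfer blast
    show "x \<le> y \<Longrightarrow> y \<le> z \<Longrightarrow> x \<le> z" by transfer blast
    show "x \<le> y \<Longrightarrow> y \<le> x \<Longrightarrow> x = y" by transfer blast
    show "inf x y \<le> x" "inf x y \<le> y" "x \<le> y \<Longrightarrow> x \<le> z \<Longrightarrow> x \<le> inf y z"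
      unfolding inf_completion_def by (auto intro: Inf_lower Inf_greatest)
    show "x \<le> sup x y" "y \<le> sup x y" "y \<le> x \<Longrightarrow> z \<le> x \<Longrightarrow> sup y z \<le> x"
      unfolding sup_completion_def by (auto intro: Sup_upper Sup_least)
    show "x \<in> A \<Longrightarrow> x \<le> Sup A" by (rule Sup_upper)
    show "(\<And>x. x \<in> A \<Longrightarrow> x \<le> z) \<Longrightarrow> Sup A \<le> z" by (rule Sup_least)
    show "x \<in> A \<Longrightarrow> Inf A \<le> x" by (rule Inf_lower)
    show "(\<And>x. x \<in> A \<Longrightarrow> z \<le> x) \<Longrightarrow> z \<le> Inf A" by (rule Inf_greatest)
  qed (simp_all add: bot_completion_def top_completion_def)
qed

end

lemma embed_le_iff: "embed x \<le> embed y \<longleftrightarrow> x \<le> y"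
  by transfer auto

lemma embed_eq_iff: "embed x = embed y \<longleftrightarrow> x = y"
  by (simp add: order_eq_iff embed_le_iff)

text \<open>Density of the embedding, the property that characterises the completion.\<close>

lemma completion_eq_Sup_embed: "x = Sup (embed ` {a. embed a \<le> x})"
proof (rule order_antisym)
  have "embed a \<le> x" if "a \<in> cut x" for a
  proof -
    have "lower_bounds (upper_bounds (cut x)) = cut x" using cut[of x] by simp
    then have "{..a} \<subseteq> cut x"
      using that by (auto simp: lower_bounds_def upper_bounds_def intro: order_trans)
    then show ?thesis by (simp add: less_eq_completion.rep_eq embed.rep_eq)
  qed
  then have "cut x \<subseteq> \<Union>(cut ` embed ` {a. embed a \<le> x})"
    by (auto simp: embed.rep_eq)
  then show "x \<le> Sup (embed ` {a. embed a \<le> x})"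
    unfolding less_eq_completion.rep_eq Sup_completion.rep_eq
    using lower_upper_extensive by blast
qed (auto intro: Sup_least)

lemma completion_eq_Inf_embed: "x = Inf (embed ` {a. x \<le> embed a})"
proof (rule order_antisym)
  show "Inf (embed ` {a. x \<le> embed a}) \<le> x"
    unfolding less_eq_completion.rep_eq Inf_completion.rep_eq
  proof
    fix b assume b: "b \<in> \<Inter> (cut ` embed ` {a. cut x \<subseteq> cut (embed a)})"
    have "b \<le> u" if "u \<in> upper_bounds (cut x)" for u
    proof -
      have "cut x \<subseteq> cut (embed u)"
        using that by (auto simp: embed.rep_eq upper_bounds_def)
      with b have "b \<in> cut (embed u)" by blast
      then show ?thesis by (simp add: embed.rep_eq)
    qed
    then have "b \<in> lower_bounds (upper_bounds (cut x))" by (simp add: lower_bounds_def)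
    then show "b \<in> cut x" using cut[of x] by simp
  qed
qed (auto intro: Inf_greatest)

abbreviation growth_order :: "(nat \<Rightarrow> nat) \<Rightarrow> growth completion" where
  "growth_order a \<equiv> embed (growth_class (\<lambda>n. real (a n)))"


section \<open>Generalized entropy\<close>

definition nonwandering :: "('a::topological_space \<Rightarrow> 'a) \<Rightarrow> 'a set" where
  "nonwandering f =
     {x. \<forall>U. open U \<and> x \<in> U \<longrightarrow> (\<exists>n\<ge>1. (f ^^ n) ` U \<inter> U \<noteq> {})}"

definition dyn_dist :: "('a::metric_space \<Rightarrow> 'a) \<Rightarrow> nat \<Rightarrow> 'a \<Rightarrow> 'a \<Rightarrow> real" where
  "dyn_dist f n x y = Max ((\<lambda>k. dist ((f ^^ k) x) ((f ^^ k) y)) ` {0..n - 1})"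

definition dyn_ball :: "('a::metric_space \<Rightarrow> 'a) \<Rightarrow> 'a \<Rightarrow> nat \<Rightarrow> real \<Rightarrow> 'a set" where
  "dyn_ball f x n \<epsilon> = {y. dyn_dist f n x y < \<epsilon>}"

definition spanning_number :: "('a::metric_space \<Rightarrow> 'a) \<Rightarrow> real \<Rightarrow> nat \<Rightarrow> nat" where
  "spanning_number f \<epsilon> n =
     (LEAST k. \<exists>F. finite F \<and> card F = k \<and> UNIV = (\<Union>x\<in>F. dyn_ball f x n \<epsilon>))"

definition gen_entropy :: "('a::metric_space \<Rightarrow> 'a) \<Rightarrow> growth completion" where
  "gen_entropy f = (SUP \<epsilon>\<in>{0<..}. growth_order (spanning_number f \<epsilon>))"


section \<open>Codings\<close>

definition infty_letter :: "'a set set \<Rightarrow> 'a set" where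
  "infty_letter \<F> = - \<Union>\<F>"

definition is_coding :: "'a set set \<Rightarrow> 'a set list \<Rightarrow> 'a list \<Rightarrow> bool" where
  "is_coding \<F> w xs \<longleftrightarrow> set w \<subseteq> insert (infty_letter \<F>) \<F> \<and> list_all2 (\<lambda>x Y. x \<in> Y) xs w"

definition orbit_segment :: "('a \<Rightarrow> 'a) \<Rightarrow> nat \<Rightarrow> 'a \<Rightarrow> 'a list" where
  "orbit_segment f n x = map (\<lambda>i. (f ^^ i) x) [0..<n]"

definition codings :: "('a \<Rightarrow> 'a) \<Rightarrow> 'a set set \<Rightarrow> nat \<Rightarrow> 'a set list set" where
  "codings f \<F> n = {w. \<exists>x. is_coding \<F> w (orbit_segment f n x)}"

definition coding_number :: "('a \<Rightarrow> 'a) \<Rightarrow> 'a set set \<Rightarrow> nat \<Rightarrow> nat" where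
  "coding_number f \<F> n = card (codings f \<F> n)"


section \<open>Mutually singular families of wandering compact neighborhoods\<close>

definition wandering :: "('a \<Rightarrow> 'a) \<Rightarrow> 'a set \<Rightarrow> bool" where
  "wandering f Y \<longleftrightarrow> (\<forall>n\<ge>1. (f ^^ n) ` Y \<inter> Y = {})"

definition compact_neighborhood :: "'a::topological_space set \<Rightarrow> bool" where
  "compact_neighborhood Y \<longleftrightarrow> compact Y \<and> (\<exists>U. open U \<and> Y = closure U)"

text \<open>Only natural times are used. For bijective \<open>f\<close> this is no restriction: integer times become
  natural after replacing \<open>x\<close> by an iterate of itself. The times are indexed by the members
  of the family.\<close>

definition mutually_singular :: "('a \<Rightarrow> 'a) \<Rightarrow> 'a set set \<Rightarrow> bool" where
  "mutually_singular f \<F> \<longleftrightarrow>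
     (\<forall>N>0::int. \<exists>x. \<exists>t :: 'a set \<Rightarrow> nat.
        (\<forall>Y\<in>\<F>. (f ^^ t Y) x \<in> Y) \<and>
        (\<forall>Y\<in>\<F>. \<forall>Z\<in>\<F>. Y \<noteq> Z \<longrightarrow> \<bar>int (t Y) - int (t Z)\<bar> > N))"

text \<open>The empty family is admitted. Members are automatically non-empty, by mutual
  singularity.\<close>

definition Sigma_fam :: "('a::topological_space \<Rightarrow> 'a) \<Rightarrow> 'a set set set" where
  "Sigma_fam f = {\<F>. finite \<F> \<and>
     (\<forall>Y\<in>\<F>. Y \<subseteq> - nonwandering f \<and> wandering f Y \<and> compact_neighborhood Y) \<and>
     mutually_singular f \<F>}"

definition Sigma_small :: "('a::metric_space \<Rightarrow> 'a) \<Rightarrow> real \<Rightarrow> 'a set set set" where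
  "Sigma_small f \<delta> = {\<F> \<in> Sigma_fam f. \<forall>Y\<in>\<F>. diameter Y < \<delta>}"

lemma Sigma_fam_nonempty_members:
  assumes "\<F> \<in> Sigma_fam f" "Y \<in> \<F>"
  shows "Y \<noteq> {}"
proof -
  have "mutually_singular f \<F>" using assms(1) by (simp add: Sigma_fam_def)
  from this[unfolded mutually_singular_def, rule_format, OF zero_less_one]
  have "\<exists>x t. \<forall>Y\<in>\<F>. (f ^^ t Y) x \<in> Y" by fast
  then show ?thesis using assms(2) by blast
qed


section \<open>The counting sequences are orders of growth\<close>

lemma dyn_dist_mono: "m \<le> n \<Longrightarrow> dyn_dist f m x y \<le> dyn_dist f n x y"
  unfolding dyn_dist_def by (rule Max_mono) auto

lemma dyn_ball_eq: "dyn_ball f x n \<epsilon> = (\<Inter>k\<in>{0..n - 1}. {y. dist ((f ^^ k) x) ((f ^^ k) y) < \<epsilon>})"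
  unfolding dyn_ball_def dyn_dist_def by (auto simp: Max_less_iff)

lemma continuous_on_funpow:
  fixes f :: "'a::topological_space \<Rightarrow> 'a"
  assumes "continuous_on UNIV f"
  shows "continuous_on UNIV (f ^^ k)"
proof (induction k)
  case (Suc k)
  then show ?case
    using continuous_on_compose[of UNIV "f ^^ k" f] continuous_on_subset[OF assms] by simp
qed simp

lemma open_dyn_ball:
  assumes "continuous_on UNIV f"
  shows "open (dyn_ball f x n \<epsilon>)"
  unfolding dyn_ball_eq using continuous_on_funpow[OF assms]
  by (intro open_INT ballI open_Collect_less continuous_intros) auto

lemma ex_spanning:
  fixes f :: "'a::metric_space \<Rightarrow> 'a"
  assumes "compact (UNIV :: 'a set)" "continuous_on UNIV f" "\<epsilon> > 0"
  shows "\<exists>F. finite F \<and> UNIV = (\<Union>x\<in>F. dyn_ball f x n \<epsilon>)"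
proof -
  have "x \<in> dyn_ball f x n \<epsilon>" for x
    using assms(3) by (simp add: dyn_ball_eq)
  then have "UNIV \<subseteq> (\<Union>x\<in>UNIV. dyn_ball f x n \<epsilon>)" by blast
  then obtain F where "F \<subseteq> UNIV" "finite F" "UNIV \<subseteq> (\<Union>x\<in>F. dyn_ball f x n \<epsilon>)"
    using compactE_image[OF assms(1), of UNIV "\<lambda>x. dyn_ball f x n \<epsilon>"] open_dyn_ball[OF assms(2)]
    by metis
  then show ?thesis by blast
qed

lemma is_growth_spanning_number:
  fixes f :: "'a::metric_space \<Rightarrow> 'a"
  assumes "compact (UNIV :: 'a set)" "continuous_on UNIV f" "\<epsilon> > 0"
  shows "is_growth (\<lambda>n. real (spanning_number f \<epsilon> n))"
  unfolding is_growth_def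
proof (intro conjI mono_onI allI impI)
  fix m n :: nat
  assume "m \<le> n"
  let ?P = "\<lambda>n k. \<exists>F. finite F \<and> card F = k \<and> UNIV = (\<Union>x\<in>F. dyn_ball f x n \<epsilon>)"
  have "\<exists>k. ?P n k" using ex_spanning[OF assms] by blast
  then have "?P n (spanning_number f \<epsilon> n)"
    unfolding spanning_number_def by (rule LeastI_ex)
  then obtain F where F: "finite F" "card F = spanning_number f \<epsilon> n"
    "UNIV = (\<Union>x\<in>F. dyn_ball f x n \<epsilon>)" by blast
  have "dyn_ball f x n \<epsilon> \<subseteq> dyn_ball f x m \<epsilon>" for x
    unfolding dyn_ball_def using dyn_dist_mono[OF \<open>m \<le> n\<close>] by (auto intro: le_less_trans)
  then have "UNIV = (\<Union>x\<in>F. dyn_ball f x m \<epsilon>)" using F(3) by blast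
  then have "?P m (spanning_number f \<epsilon> n)" using F by blast
  then show "real (spanning_number f \<epsilon> m) \<le> real (spanning_number f \<epsilon> n)"
    unfolding spanning_number_def[of f \<epsilon> m] of_nat_le_iff by (rule Least_le)
qed simp

lemma finite_codings:
  assumes "finite \<F>"
  shows "finite (codings f \<F> n)"
proof (rule finite_subset)
  show "codings f \<F> n \<subseteq> {w. set w \<subseteq> insert (infty_letter \<F>) \<F> \<and> length w = n}"
    by (auto simp: codings_def is_coding_def orbit_segment_def dest: list_all2_lengthD)
  show "finite {w. set w \<subseteq> insert (infty_letter \<F>) \<F> \<and> length w = n}"
    using assms by (intro finite_lists_length_eq) simp
qed

lemma is_growth_coding_number:
  assumes "finite \<F>"
  shows "is_growth (\<lambda>n. real (coding_number f \<F> n))"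
proof -
  have "coding_number f \<F> n \<le> coding_number f \<F> (Suc n)" for n
    unfolding coding_number_def
  proof (rule surj_card_le[OF finite_codings[OF assms]])
    show "codings f \<F> n \<subseteq> butlast ` codings f \<F> (Suc n)"
    proof
      fix w assume "w \<in> codings f \<F> n"
      then obtain x where x: "is_coding \<F> w (orbit_segment f n x)"
        unfolding codings_def by blast
      obtain Y where Y: "Y \<in> insert (infty_letter \<F>) \<F>" "(f ^^ n) x \<in> Y"
        unfolding infty_letter_def by (cases "(f ^^ n) x \<in> \<Union>\<F>") auto
      have "is_coding \<F> (w @ [Y]) (orbit_segment f (Suc n) x)"
        using x Y by (auto simp: is_coding_def orbit_segment_def intro: list_all2_appendI)
      then have "w @ [Y] \<in> codings f \<F> (Suc n)" unfolding codings_def by blast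
      then show "w \<in> butlast ` codings f \<F> (Suc n)" by (intro rev_image_eqI[of "w @ [Y]"]) auto
    qed
  qed
  then have "mono (coding_number f \<F>)" by (simp add: mono_iff_le_Suc)
  then show ?thesis by (auto simp: is_growth_def mono_on_def mono_def)
qed

end

theory Submission
  imports Defs
begin

text \<open>
  An orbit meets a wandering set at most once, so it meets a small neighborhood of a compact subset
  of \<open>M \<setminus> \<Omega>(f)\<close> boundedly often. Hence the orbit segments that follow a given one up to a small
  \<open>\<epsilon>\<close> have boundedly many codings, and \<open>c\<^sub>\<F> \<lesssim> g\<^sub>\<epsilon>\<close>.

  Conversely, let \<open>\<F>\<close> be a cover by small wandering neighborhoods of the complement of tiny
  balls around the finitely many points of \<open>\<Omega>(f)\<close>. Two orbits with the same coding are close at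
  all times: at a letter \<open>\<infinity>\<close> both are close to \<open>\<Omega>(f)\<close>, and close to the same point of it since they
  were close one step earlier. Only the ball at time 0 has to be recorded, so
  \<open>g\<^sub>\<epsilon> \<lesssim> c\<^sub>\<F>\<close>. This \<open>\<F>\<close> need not be mutually singular. A coding amounts to the set
  \<open>S\<close> of its letters together with their times of occurrence, and if \<open>S\<close> is not mutually singular,
  then two of the times differ by a bounded amount, so that one of the letters can be dropped at the
  price of a constant factor. By induction, \<open>c\<^sub>\<F>\<close> is bounded by a combination of the \<open>c\<^sub>S\<close> with
  \<open>S \<subseteq> \<F>\<close> mutually singular.
\<close>

section \<open>Orders of growth\<close>

lemma growth_class_cases:
  obtains u where "x = growth_class u" "is_growth u"
  by (induct x rule: growth.abs_induct) (auto simp: growth_equiv_iff)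

text \<open>Each element of the completion is the infimum of the embedded elements above it. A
  supremum of orders of growth, which need not be one itself, can thus be compared through its upper
  bounds \<open>u\<close> only.\<close>

lemma embed_le_completionI:
  assumes "\<And>u. x \<le> embed u \<Longrightarrow> a \<le> u"
  shows "embed a \<le> x"
  by (subst completion_eq_Inf_embed[of x], rule Inf_greatest) (auto simp: embed_le_iff intro: assms)

lemma growth_order_le_iff:
  assumes "is_growth (\<lambda>n. real (a n))" "is_growth (\<lambda>n. real (b n))"
  shows "growth_order a \<le> growth_order b \<longleftrightarrow> growth_le (\<lambda>n. real (a n)) (\<lambda>n. real (b n))"
  using assms by (simp add: embed_le_iff growth_class_le_iff)

section \<open>Visits to wandering sets\<close>

text \<open>Of two visits, the later point is the image of the earlier one under a positive
  iterate.\<close>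

lemma wandering_visit_unique:
  assumes "wandering f Y" "(f ^^ i) x \<in> Y" "(f ^^ j) x \<in> Y"
  shows "i = j"
proof -
  have *: False if "i < j" "(f ^^ i) x \<in> Y" "(f ^^ j) x \<in> Y" for i j
  proof -
    have "(f ^^ j) x = (f ^^ (j - i)) ((f ^^ i) x)"
      using that(1) funpow_add[of "j - i" i f] by simp
    then have "(f ^^ j) x \<in> (f ^^ (j - i)) ` Y \<inter> Y" using that by auto
    moreover have "1 \<le> j - i" using that(1) by simp
    ultimately show False using assms(1) unfolding wandering_def by blast
  qed
  show ?thesis using *[of i j] *[of j i] assms(2,3) by (meson linorder_neqE_nat)
qed

lemma wandering_subset: "wandering f Y \<Longrightarrow> Z \<subseteq> Y \<Longrightarrow> wandering f Z"
  unfolding wandering_def by blast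

lemma not_nonwandering_iff:
  "x \<notin> nonwandering f \<longleftrightarrow> (\<exists>U. open U \<and> x \<in> U \<and> wandering f U)"
  unfolding nonwandering_def wandering_def by blast

lemma open_wandering_disjoint: "open U \<Longrightarrow> wandering f U \<Longrightarrow> U \<subseteq> - nonwandering f"
  using not_nonwandering_iff by fastforce

text \<open>Cover \<open>K\<close> by finitely many open wandering sets and take \<epsilon> from the
  Lebesgue covering lemma. Being \<epsilon>-near \<open>K\<close> then means lying in a member of
  the cover, and each member is visited at most once.\<close>

lemma bounded_visits_near_compact:
  fixes f :: "'a::metric_space \<Rightarrow> 'a"
  assumes "compact K" "K \<inter> nonwandering f = {}"
  obtains \<epsilon> N where "\<epsilon> > 0"
    "\<And>x. finite {i. \<exists>y\<in>K. dist y ((f ^^ i) x) < \<epsilon>}"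
    "\<And>x. card {i. \<exists>y\<in>K. dist y ((f ^^ i) x) < \<epsilon>} \<le> N"
proof -
  let ?\<U> = "{U. open U \<and> wandering f U}"
  have "K \<subseteq> \<Union>?\<U>" using assms(2) not_nonwandering_iff[of _ f] by blast
  then obtain D where D: "D \<subseteq> ?\<U>" "finite D" "K \<subseteq> \<Union>D"
    using compactE[OF assms(1), of ?\<U>] by (metis (no_types, lifting) mem_Collect_eq)
  obtain \<epsilon> where e: "\<epsilon> > 0" "\<And>y. y \<in> K \<Longrightarrow> \<exists>U\<in>D. ball y \<epsilon> \<subseteq> U"
    using Heine_Borel_lemma[OF assms(1) D(3)] D(1) by blast
  have sub: "{i. \<exists>y\<in>K. dist y ((f ^^ i) x) < \<epsilon>} \<subseteq> (\<Union>U\<in>D. {i. (f ^^ i) x \<in> U})" for x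
    using e(2) by fastforce
  have one: "finite {i. (f ^^ i) x \<in> U} \<and> card {i. (f ^^ i) x \<in> U} \<le> 1" if "U \<in> D" for U x
  proof -
    have "\<exists>j. {i. (f ^^ i) x \<in> U} \<subseteq> {j}"
      using wandering_visit_unique[of f U _ x] D(1) that by blast
    then obtain j where j: "{i. (f ^^ i) x \<in> U} \<subseteq> {j}" by blast
    show ?thesis using finite_subset[OF j] card_mono[OF _ j] by simp
  qed
  have fin: "finite (\<Union>U\<in>D. {i. (f ^^ i) x \<in> U})" for x using D(2) one by blast
  have "card (\<Union>U\<in>D. {i. (f ^^ i) x \<in> U}) \<le> card D" for x
    using card_UN_le[OF D(2), of "\<lambda>U. {i. (f ^^ i) x \<in> U}"]
      sum_bounded_above[of D "\<lambda>U. card {i. (f ^^ i) x \<in> U}" 1] one by fastforce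
  then have "card {i. \<exists>y\<in>K. dist y ((f ^^ i) x) < \<epsilon>} \<le> card D" for x
    using card_mono[OF fin sub] le_trans by blast
  then show thesis using that[OF e(1)] finite_subset[OF sub fin] by blast
qed

section \<open>Codings are bounded by the spanning numbers\<close>

lemma coding_iff:
  "is_coding \<F> w (orbit_segment f n x) \<longleftrightarrow>
     length w = n \<and> (\<forall>i<n. w ! i \<in> insert (infty_letter \<F>) \<F> \<and> (f ^^ i) x \<in> w ! i)"
  unfolding is_coding_def orbit_segment_def list_all2_conv_all_nth set_conv_nth by auto

lemma ex_coding: "\<exists>w. is_coding \<F> w (orbit_segment f n x)"
proof -
  have "\<exists>Y. Y \<in> insert (infty_letter \<F>) \<F> \<and> y \<in> Y" for y
    unfolding infty_letter_def by (cases "y \<in> \<Union>\<F>") auto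
  then obtain c where "\<And>y. c y \<in> insert (infty_letter \<F>) \<F> \<and> y \<in> c y" by metis
  then show ?thesis
    by (intro exI[of _ "map (\<lambda>i. c ((f ^^ i) x)) [0..<n]"]) (simp add: coding_iff)
qed

text \<open>The letter \<infinity> can belong to \<F> only as the empty set, and a letter of a
  coding contains a point.\<close>

lemma coding_eq_infty_iff:
  assumes "is_coding \<F> w (orbit_segment f n x)" "i < n"
  shows "w ! i \<noteq> infty_letter \<F> \<longleftrightarrow> w ! i \<in> \<F>"
  using assms unfolding coding_iff infty_letter_def by blast

text \<open>At \<open>n = 0\<close> truncated subtraction turns \<open>{0..n - 1}\<close> into
  \<open>{0}\<close>, whence \<open>n \<ge> 1\<close>.\<close>

lemma mem_dyn_ball_iff:
  "n \<ge> 1 \<Longrightarrow> y \<in> dyn_ball f x n \<epsilon> \<longleftrightarrow> (\<forall>k<n. dist ((f ^^ k) x) ((f ^^ k) y) < \<epsilon>)"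
  unfolding dyn_ball_eq by (force simp: less_eq_Suc_le)

lemma spanning_number_attained:
  fixes f :: "'a::metric_space \<Rightarrow> 'a"
  assumes "compact (UNIV :: 'a set)" "continuous_on UNIV f" "\<epsilon> > 0"
  obtains E where "finite E" "card E = spanning_number f \<epsilon> n" "UNIV = (\<Union>x\<in>E. dyn_ball f x n \<epsilon>)"
proof -
  have "\<exists>k F. finite F \<and> card F = k \<and> UNIV = (\<Union>x\<in>F. dyn_ball f x n \<epsilon>)"
    using ex_spanning[OF assms] by blast
  from LeastI_ex[OF this] show thesis
    using that unfolding spanning_number_def by blast
qed

text \<open>Codings of points in one dynamical ball can have a letter other than \<infinity> only at
  the at most \<open>N\<close> times when the center is near \<open>\<Union>\<F>\<close>. So each
  ball of a minimal cover contributes at most \<open>card ?L ^ N\<close> words.\<close>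

lemma coding_number_le_spanning_number:
  fixes f :: "'a::metric_space \<Rightarrow> 'a"
  assumes "compact (UNIV :: 'a set)" "continuous_on UNIV f"
    and "finite \<F>" "compact (\<Union>\<F>)" "\<Union>\<F> \<inter> nonwandering f = {}"
  obtains \<epsilon> where "\<epsilon> > 0"
    "growth_le (\<lambda>n. real (coding_number f \<F> n)) (\<lambda>n. real (spanning_number f \<epsilon> n))"
proof -
  obtain \<epsilon> N where e: "\<epsilon> > 0"
    and fin: "\<And>x. finite {i. \<exists>y\<in>\<Union>\<F>. dist y ((f ^^ i) x) < \<epsilon>}"
    and N: "\<And>x. card {i. \<exists>y\<in>\<Union>\<F>. dist y ((f ^^ i) x) < \<epsilon>} \<le> N"
    using bounded_visits_near_compact[OF assms(4,5)] by blast
  let ?V = "\<lambda>x. {i. \<exists>y\<in>\<Union>\<F>. dist y ((f ^^ i) x) < \<epsilon>}"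
  let ?L = "insert (infty_letter \<F>) \<F>"
  have L: "finite ?L" "card ?L > 0" using assms(3) by (simp_all add: card_gt_0_iff)
  have le: "coding_number f \<F> n \<le> card ?L ^ N * spanning_number f \<epsilon> n" if n: "n \<ge> 1" for n
  proof -
    obtain E where E: "finite E" "card E = spanning_number f \<epsilon> n"
      "UNIV = (\<Union>x\<in>E. dyn_ball f x n \<epsilon>)"
      using spanning_number_attained[OF assms(1,2) e] by blast
    define W where "W e = {w. \<exists>x \<in> dyn_ball f e n \<epsilon>. is_coding \<F> w (orbit_segment f n x)}" for e
    have W: "finite (W e) \<and> card (W e) \<le> card ?L ^ N" for e
    proof -
      \<comment> \<open>Outside the times at which the center of the ball is near \<open>\<Union>\<F>\<close>, the letter is \<open>\<infinity>\<close>.\<close>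
      have "W e \<subseteq> (\<lambda>g. map (\<lambda>i. if i \<in> ?V e then g i else infty_letter \<F>) [0..<n]) ` (?V e \<rightarrow>\<^sub>E ?L)"
        (is "_ \<subseteq> ?d ` _")
      proof
        fix w assume "w \<in> W e"
        then obtain x where x: "x \<in> dyn_ball f e n \<epsilon>" "is_coding \<F> w (orbit_segment f n x)"
          unfolding W_def by blast
        \<comment> \<open>\<open>?V e\<close> may contain times beyond the word; there
          \<open>g\<close> takes the filler \<infinity>.\<close>
        define g where
          "g = restrict (\<lambda>i. if i < n then w ! i else infty_letter \<F>) (?V e)"
        have "i \<in> ?V e" if "i < n" "w ! i \<noteq> infty_letter \<F>" for i
        proof -
          have "w ! i \<in> \<F>" using coding_eq_infty_iff[OF x(2) that(1)] that(2) by blast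
          moreover have "(f ^^ i) x \<in> w ! i" using x(2) that(1) by (simp add: coding_iff)
          moreover have "dist ((f ^^ i) x) ((f ^^ i) e) < \<epsilon>"
            using x(1) n that(1) by (simp add: mem_dyn_ball_iff dist_commute)
          ultimately show ?thesis by blast
        qed
        then have "w = ?d g"
          using x(2) by (intro nth_equalityI) (auto simp: coding_iff g_def)
        moreover have "g \<in> ?V e \<rightarrow>\<^sub>E ?L"
          unfolding g_def using x(2) by (intro restrict_PiE_iff[THEN iffD2]) (auto simp: coding_iff)
        ultimately show "w \<in> ?d ` (?V e \<rightarrow>\<^sub>E ?L)" by blast
      qed
      moreover have "finite (?V e \<rightarrow>\<^sub>E ?L)" using fin L by (intro finite_PiE) auto
      moreover have "card (?V e \<rightarrow>\<^sub>E ?L) \<le> card ?L ^ N"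
        using fin N[of e] L by (simp add: card_PiE power_increasing)
      ultimately show ?thesis by (meson finite_surj surj_card_le le_trans)
    qed
    have "codings f \<F> n \<subseteq> (\<Union>e\<in>E. W e)"
      unfolding codings_def W_def using E(3) by blast
    then have "coding_number f \<F> n \<le> card (\<Union>e\<in>E. W e)"
      unfolding coding_number_def using E(1) W by (intro card_mono) auto
    also have "\<dots> \<le> (\<Sum>e\<in>E. card (W e))" using E(1) by (rule card_UN_le)
    also have "\<dots> \<le> card E * card ?L ^ N" using sum_bounded_above[of E "\<lambda>e. card (W e)"] W by simp
    finally show ?thesis using E(2) by (simp add: mult.commute)
  qed
  have "growth_le (\<lambda>n. real (coding_number f \<F> n)) (\<lambda>n. real (spanning_number f \<epsilon> n))"
    unfolding growth_le_def
  proof (intro exI[of _ "real (card ?L ^ N)"] conjI allI impI)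
    show "0 < real (card ?L ^ N)" using L(2) by simp
    show "real (coding_number f \<F> n) \<le> real (card ?L ^ N) * real (spanning_number f \<epsilon> n)"
      if "1 \<le> n" for n using le[OF that] by (metis of_nat_le_iff of_nat_mult)
  qed
  then show thesis using that e by blast
qed

section \<open>Spanning numbers are bounded by the codings of a fine family\<close>

lemma finite_set_separated:
  fixes A :: "'a::metric_space set"
  assumes "finite A"
  obtains s where "s > 0" "\<And>p q. p \<in> A \<Longrightarrow> q \<in> A \<Longrightarrow> dist p q < 3 * s \<Longrightarrow> p = q"
proof -
  let ?D = "(\<lambda>(p, q). dist p q) ` {(p, q) \<in> A \<times> A. p \<noteq> q}"
  \<comment> \<open>The inserted 1 keeps the minimum defined when \<open>A\<close> has at most one
    point.\<close>
  let ?s = "Min (insert 1 ?D) / 3"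
  have fin: "finite ?D"
    using finite_subset[of "{(p, q) \<in> A \<times> A. p \<noteq> q}" "A \<times> A"] assms by fastforce
  have "?s > 0" using fin by (subst zero_less_divide_iff, subst Min_gr_iff) auto
  moreover have "p = q" if "p \<in> A" "q \<in> A" "dist p q < 3 * ?s" for p q
  proof (rule ccontr)
    assume "p \<noteq> q"
    then have "dist p q \<in> insert 1 ?D" using that by force
    then have "Min (insert 1 ?D) \<le> dist p q" using fin by (intro Min_le) auto
    then show False using that by simp
  qed
  ultimately show thesis using that by blast
qed

text \<open>Shrink a ball into an open wandering set around \<open>x\<close>. The closure of the
  open ball is taken because \<open>cball\<close> need not be the closure of an open set.\<close>

lemma ex_small_wandering_compact_neighborhood:
  fixes f :: "'a::metric_space \<Rightarrow> 'a"
  assumes "compact (UNIV :: 'a set)" "x \<notin> nonwandering f" "\<delta> > 0"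
  obtains \<rho> where "\<rho> > 0" "closure (ball x \<rho>) \<subseteq> - nonwandering f" "wandering f (closure (ball x \<rho>))"
    "compact_neighborhood (closure (ball x \<rho>))" "diameter (closure (ball x \<rho>)) < \<delta>"
proof -
  obtain U where U: "open U" "x \<in> U" "wandering f U" using assms(2) not_nonwandering_iff by blast
  then obtain \<rho>' where r': "\<rho>' > 0" "cball x \<rho>' \<subseteq> U" by (meson open_contains_cball)
  \<comment> \<open>The diameter is at most \<open>2 * \<rho>\<close>, hence below \<delta>.\<close>
  define \<rho> where "\<rho> = min \<rho>' (\<delta> / 3)"
  have r: "\<rho> > 0" "\<rho> \<le> \<rho>'" "\<rho> \<le> \<delta> / 3" using r' assms(3) by (auto simp: \<rho>_def)
  let ?Y = "closure (ball x \<rho>)"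
  have sub: "?Y \<subseteq> cball x \<rho>" by (intro closure_minimal ball_subset_cball closed_cball)
  then have "?Y \<subseteq> U" using r' r by force
  then have "?Y \<subseteq> - nonwandering f" "wandering f ?Y"
    using open_wandering_disjoint[OF U(1,3)] wandering_subset[OF U(3)] by auto
  moreover have "compact_neighborhood ?Y"
    unfolding compact_neighborhood_def using assms(1) compact_Int_closed[of UNIV ?Y] by auto
  moreover have "diameter ?Y < \<delta>"
  proof -
    have "?Y \<times> ?Y \<noteq> {}" using r closure_subset[of "ball x \<rho>"] by auto
    moreover have "dist y z \<le> 2 * \<rho>" if "y \<in> ?Y" "z \<in> ?Y" for y z
    proof -
      have "dist x y \<le> \<rho>" "dist x z \<le> \<rho>" using sub that by auto
      then show ?thesis using dist_triangle3[of y z x] by linarith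
    qed
    ultimately have "diameter ?Y \<le> 2 * \<rho>"
      unfolding diameter_def by (subst if_not_P) (auto intro: cSUP_least)
    then show ?thesis using r by linarith
  qed
  ultimately show thesis using that r(1) by blast
qed

lemma ex_fine_wandering_cover:
  fixes f :: "'a::metric_space \<Rightarrow> 'a"
  assumes "compact (UNIV :: 'a set)" "closed A" "A \<inter> nonwandering f = {}" "\<delta> > 0"
  obtains \<F> where "finite \<F>" "A \<subseteq> \<Union>\<F>"
    "\<forall>Y\<in>\<F>. Y \<subseteq> - nonwandering f \<and> wandering f Y \<and> compact_neighborhood Y \<and> diameter Y < \<delta>"
proof -
  have "\<forall>x\<in>A. \<exists>\<rho>>0. closure (ball x \<rho>) \<subseteq> - nonwandering f \<and> wandering f (closure (ball x \<rho>)) \<and>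
    compact_neighborhood (closure (ball x \<rho>)) \<and> diameter (closure (ball x \<rho>)) < \<delta>"
    using ex_small_wandering_compact_neighborhood[OF assms(1) _ assms(4)] assms(3) by blast
  then obtain \<rho> where r: "\<And>x. x \<in> A \<Longrightarrow> \<rho> x > 0 \<and> closure (ball x (\<rho> x)) \<subseteq> - nonwandering f \<and>
    wandering f (closure (ball x (\<rho> x))) \<and> compact_neighborhood (closure (ball x (\<rho> x))) \<and>
    diameter (closure (ball x (\<rho> x))) < \<delta>" by metis
  have "compact A" using compact_Int_closed[OF assms(1,2)] by simp
  then obtain C where C: "C \<subseteq> A" "finite C" "A \<subseteq> (\<Union>x\<in>C. ball x (\<rho> x))"
    by (rule compactE_image[of A A "\<lambda>x. ball x (\<rho> x)"]) (use r in force)+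
  let ?\<F> = "(\<lambda>x. closure (ball x (\<rho> x))) ` C"
  have "A \<subseteq> \<Union>?\<F>" using C(3) closure_subset by blast
  then show thesis using that[of ?\<F>] C(1,2) r by (auto simp: subset_iff)
qed

lemma spanning_number_le_coding_number:
  fixes f :: "'a::metric_space \<Rightarrow> 'a"
  assumes "compact (UNIV :: 'a set)" "continuous_on UNIV f" "finite (nonwandering f)"
    and "\<epsilon> > 0" "\<delta> > 0"
  obtains \<F> where "finite \<F>"
    "\<forall>Y\<in>\<F>. Y \<subseteq> - nonwandering f \<and> wandering f Y \<and> compact_neighborhood Y \<and> diameter Y < \<delta>"
    "growth_le (\<lambda>n. real (spanning_number f \<epsilon> n)) (\<lambda>n. real (coding_number f \<F> n))"
proof -
  let ?\<Omega> = "nonwandering f"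
  obtain s where s: "s > 0" "\<And>p q. p \<in> ?\<Omega> \<Longrightarrow> q \<in> ?\<Omega> \<Longrightarrow> dist p q < 3 * s \<Longrightarrow> p = q"
    using finite_set_separated[OF assms(3)] by blast
  \<comment> \<open>Uniform continuity carries closeness over one time step: \<eta>-close points
    have \<open>s\<close>-close images.\<close>
  obtain \<eta>' where e': "\<eta>' > 0" "\<And>x y. dist x y < \<eta>' \<Longrightarrow> dist (f x) (f y) < s"
    using compact_uniformly_continuous[OF assms(2,1)] s(1)
    unfolding uniformly_continuous_on_def by (metis UNIV_I)
  define \<eta> where "\<eta> = min \<epsilon> \<eta>'"
  have eta: "\<eta> > 0" "\<eta> \<le> \<epsilon>" "\<And>x y. dist x y < \<eta> \<Longrightarrow> dist (f x) (f y) < s"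
    using e' assms(4) by (auto simp: \<eta>_def)
  \<comment> \<open>\<open>2 * r \<le> \<eta>\<close> makes two points in one ball \<eta>-close;
    \<open>r \<le> s\<close> gives \<open>r + s + r \<le> 3 * s\<close>, so that
    \<open>s\<close>-close points cannot lie in the balls of different points of
    \<open>?\<Omega>\<close>.\<close>
  define r where "r = min s (\<eta> / 2)"
  have r: "r > 0" "r \<le> s" "2 * r \<le> \<eta>" using s(1) eta(1) by (auto simp: r_def)
  let ?A = "- (\<Union>p\<in>?\<Omega>. ball p r)"
  have "closed ?A" by (intro closed_Compl open_UN) simp
  moreover have "?A \<inter> ?\<Omega> = {}" using r(1) by force
  ultimately obtain \<F> where F: "finite \<F>" "?A \<subseteq> \<Union>\<F>" and
    F': "\<forall>Y\<in>\<F>. Y \<subseteq> - ?\<Omega> \<and> wandering f Y \<and> compact_neighborhood Y \<and> diameter Y < min \<delta> \<eta>"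
    using ex_fine_wandering_cover[OF assms(1), of ?A f "min \<delta> \<eta>"] assms(5) eta(1) by auto
  have inf: "\<exists>p\<in>?\<Omega>. dist p x < r" if "x \<in> infty_letter \<F>" for x
    using that F(2) by (fastforce simp: infty_letter_def)
  have letter: "dist x y < \<eta>" if "Y \<in> \<F>" "x \<in> Y" "y \<in> Y" for x y Y
  proof -
    have "bounded Y" using F' that(1) compact_imp_bounded by (auto simp: compact_neighborhood_def)
    then have "dist x y \<le> diameter Y" using that by (intro diameter_bounded_bound)
    then show ?thesis using F' that(1) by fastforce
  qed
  have le: "spanning_number f \<epsilon> n \<le> (card ?\<Omega> + 1) * coding_number f \<F> n" if n: "n \<ge> 1" for n
  proof -
    \<comment> \<open>A junk value for the recorded ball, used when the first letter is not \<open>\<infinity>\<close>.\<close>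
    define a :: 'a where "a = undefined"
    \<comment> \<open>The pair \<open>(w, q)\<close> is to determine the orbit segment up to \<eta>.
      The point \<open>q\<close> matters only if the word starts with \<infinity>, where no earlier
      closeness can select the ball.\<close>
    define P where "P x w q \<longleftrightarrow> is_coding \<F> w (orbit_segment f n x) \<and>
      (w ! 0 \<in> \<F> \<or> q \<in> ?\<Omega> \<and> dist q x < r)" for x w q
    have close: "dist ((f ^^ k) x) ((f ^^ k) y) < \<eta>" if P: "P x w q" "P y w q" and "k < n" for x y w q k
      using \<open>k < n\<close>
    proof (induction k)
      case 0
      show ?case
      proof (cases "w ! 0 \<in> \<F>")
        case True
        then show ?thesis using letter[OF True, of x y] P 0 by (force simp: P_def coding_iff)
      next
        case False
        then have "dist q x < r" "dist q y < r" using P by (auto simp: P_def)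
        then show ?thesis using r(3) dist_triangle3[of x y q] by simp
      qed
    next
      case (Suc k)
      let ?x = "(f ^^ Suc k) x" and ?y = "(f ^^ Suc k) y"
      have mem: "?x \<in> w ! Suc k" "?y \<in> w ! Suc k" "w ! Suc k \<in> insert (infty_letter \<F>) \<F>"
        using P Suc.prems unfolding P_def coding_iff by blast+
      show ?case
      proof (cases "w ! Suc k \<in> \<F>")
        case True
        then show ?thesis using letter mem by blast
      next
        case False
        then obtain p p' where p: "p \<in> ?\<Omega>" "p' \<in> ?\<Omega>" "dist p ?x < r" "dist p' ?y < r"
          using mem inf by (metis insertE)
        have "dist ?x ?y < s" using Suc by (simp add: eta(3))
        then have "dist p p' < r + s + r"
          using p dist_triangle[of p p' ?x] dist_triangle[of ?x p' ?y] by (simp add: dist_commute)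
        then have "p = p'" using r(2) p by (intro s(2)) auto
        then show ?thesis using p r(3) dist_triangle3[of ?x ?y p] by simp
      qed
    qed
    define K where "K = codings f \<F> n \<times> insert a ?\<Omega>"
    have finK: "finite K" unfolding K_def using finite_codings[OF F(1)] assms(3) by blast
    have "card (insert a ?\<Omega>) \<le> card ?\<Omega> + 1" using card_insert_if[OF assms(3)] by simp
    then have cardK: "card K \<le> (card ?\<Omega> + 1) * coding_number f \<F> n"
      unfolding K_def card_cartesian_product coding_number_def
      by (subst mult.commute) (rule mult_right_mono, simp_all)
    \<comment> \<open>One representative per pair; a pair that no point realizes gets an arbitrary
      one, which does no harm in a spanning set.\<close>
    define e where "e = (\<lambda>(w, q). SOME x. P x w q)"
    have "UNIV = (\<Union>x\<in>e ` K. dyn_ball f x n \<epsilon>)"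
    proof (intro subset_antisym subsetI)
      fix y :: 'a
      obtain w where w: "is_coding \<F> w (orbit_segment f n y)" using ex_coding[of \<F> f n y] by blast
      have "\<exists>q\<in>insert a ?\<Omega>. P y w q"
      proof (cases "w ! 0 \<in> \<F>")
        case False
        then have "y \<in> infty_letter \<F>" using w n unfolding coding_iff
          by (metis (no_types, lifting) funpow_0 insertE less_le_trans zero_less_one)
        then show ?thesis using inf w by (auto simp: P_def)
      qed (use w in \<open>auto simp: P_def\<close>)
      then obtain q where q: "q \<in> insert a ?\<Omega>" "P y w q" by blast
      then have k: "(w, q) \<in> K" using w by (auto simp: K_def codings_def)
      have "P (e (w, q)) w q" unfolding e_def using q(2) by (auto intro: someI)
      then have "y \<in> dyn_ball f (e (w, q)) n \<epsilon>"
        using close q(2) n eta(2) by (fastforce simp: mem_dyn_ball_iff)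
      then show "y \<in> (\<Union>x\<in>e ` K. dyn_ball f x n \<epsilon>)" using k by blast
    qed simp
    then have "\<exists>E. finite E \<and> card E = card (e ` K) \<and> UNIV = (\<Union>x\<in>E. dyn_ball f x n \<epsilon>)"
      using finK by (intro exI[of _ "e ` K"]) simp
    then have "spanning_number f \<epsilon> n \<le> card (e ` K)"
      unfolding spanning_number_def by (rule Least_le)
    also have "\<dots> \<le> card K" using finK by (rule card_image_le)
    finally show ?thesis using cardK by simp
  qed
  have "growth_le (\<lambda>n. real (spanning_number f \<epsilon> n)) (\<lambda>n. real (coding_number f \<F> n))"
    unfolding growth_le_def
  proof (intro exI[of _ "real (card ?\<Omega> + 1)"] conjI allI impI)
    show "real (spanning_number f \<epsilon> n) \<le> real (card ?\<Omega> + 1) * real (coding_number f \<F> n)"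
      if "1 \<le> n" for n using le[OF that] by (metis of_nat_le_iff of_nat_mult)
  qed simp
  then show thesis using that F(1) F' by auto
qed

section \<open>Reduction to mutually singular families\<close>

text \<open>The point \<open>x\<close> is forgotten: only the times are counted. Injectivity
  reflects that a position of a word holds one letter, although members of \<open>S\<close> may
  overlap; \<open>\<rightarrow>\<^sub>E\<close> makes the set finite for finite
  \<open>S\<close>.\<close>

definition visit_times :: "('a \<Rightarrow> 'a) \<Rightarrow> 'a set set \<Rightarrow> nat \<Rightarrow> ('a set \<Rightarrow> nat) set" where
  "visit_times f S n =
     {t \<in> S \<rightarrow>\<^sub>E {..<n}. inj_on t S \<and> (\<exists>x. \<forall>Y\<in>S. (f ^^ t Y) x \<in> Y)}"

text \<open>\<F> is kept apart from the set \<open>S\<close> of letters that occur, because the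
  letter \<infinity> depends on the whole family.\<close>

definition word_of_times :: "'a set set \<Rightarrow> 'a set set \<Rightarrow> nat \<Rightarrow> ('a set \<Rightarrow> nat) \<Rightarrow> 'a set list" where
  "word_of_times \<F> S n t =
     map (\<lambda>i. if i \<in> t ` S then the_inv_into S t i else infty_letter \<F>) [0..<n]"

lemma finite_visit_times: "finite S \<Longrightarrow> finite (visit_times f S n)"
  unfolding visit_times_def by (auto intro!: finite_PiE)

lemma word_of_times_nth:
  assumes "inj_on t S" "Y \<in> S" "t Y < n"
  shows "word_of_times \<F> S n t ! t Y = Y"
  using assms by (simp add: word_of_times_def the_inv_into_f_f)

text \<open>A wandering letter occurs at most once in a coding, so the letters other than
  \<infinity> and their times determine the word.\<close>

lemma codings_subset_words_of_times:
  assumes "\<And>Y. Y \<in> \<F> \<Longrightarrow> wandering f Y"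
  shows "codings f \<F> n \<subseteq>
    (\<lambda>(S, t). word_of_times \<F> S n t) ` (SIGMA S:Pow \<F>. visit_times f S n)"
proof
  fix w assume "w \<in> codings f \<F> n"
  then obtain x where x: "is_coding \<F> w (orbit_segment f n x)" unfolding codings_def by blast
  then have len: "length w = n" and vis: "\<And>i. i < n \<Longrightarrow> (f ^^ i) x \<in> w ! i"
    by (auto simp: coding_iff)
  define S where "S = set w \<inter> \<F>"
  have "\<forall>Y\<in>S. \<exists>i<n. w ! i = Y" by (auto simp: S_def in_set_conv_nth len)
  then obtain t' where t': "\<And>Y. Y \<in> S \<Longrightarrow> t' Y < n \<and> w ! t' Y = Y" by metis
  define t where "t = restrict t' S"
  have t: "t Y < n" "w ! t Y = Y" if "Y \<in> S" for Y using t' that by (auto simp: t_def)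
  have inj: "inj_on t S" by (rule inj_onI) (metis t(2))
  have "(f ^^ t Y) x \<in> Y" if "Y \<in> S" for Y using vis[OF t(1)[OF that]] t(2)[OF that] by simp
  then have "t \<in> visit_times f S n"
    unfolding visit_times_def using t inj by (auto simp: t_def)
  moreover have "w = word_of_times \<F> S n t"
  proof (rule nth_equalityI)
    fix i assume "i < length w"
    then have i: "i < n" using len by simp
    show "w ! i = word_of_times \<F> S n t ! i"
    proof (cases "i \<in> t ` S")
      case True
      then show ?thesis using t word_of_times_nth[OF inj] by force
    next
      case False
      have "w ! i = infty_letter \<F>"
      proof (rule ccontr)
        assume "w ! i \<noteq> infty_letter \<F>"
        then have "w ! i \<in> S" using coding_eq_infty_iff[OF x i] i len by (simp add: S_def)
        moreover have "t (w ! i) = i"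
          using wandering_visit_unique[OF assms, of "w ! i" "t (w ! i)" x i] calculation
            vis[OF i] vis[OF t(1)[OF calculation]] t(2)[OF calculation] by (simp add: S_def)
        ultimately show False using False by (metis imageI)
      qed
      then show ?thesis using False i by (simp add: word_of_times_def)
    qed
  qed (simp add: len word_of_times_def)
  moreover have "S \<subseteq> \<F>" by (simp add: S_def)
  ultimately show "w \<in> (\<lambda>(S, t). word_of_times \<F> S n t) ` (SIGMA S:Pow \<F>. visit_times f S n)"
    by (intro image_eqI[of _ _ "(S, t)"]) simp_all
qed

lemma coding_number_le_sum_visit_times:
  assumes "finite \<F>" "\<And>Y. Y \<in> \<F> \<Longrightarrow> wandering f Y"
  shows "coding_number f \<F> n \<le> (\<Sum>S\<in>Pow \<F>. card (visit_times f S n))"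
proof -
  have fin: "finite (SIGMA S:Pow \<F>. visit_times f S n)"
    using assms(1) by (intro finite_SigmaI finite_visit_times) (auto intro: finite_subset)
  have "coding_number f \<F> n \<le> card (SIGMA S:Pow \<F>. visit_times f S n)"
    unfolding coding_number_def using codings_subset_words_of_times[OF assms(2)]
    by (rule surj_card_le[OF fin])
  also have "\<dots> = (\<Sum>S\<in>Pow \<F>. card (visit_times f S n))"
    using assms(1) by (intro card_SigmaI) (auto intro: finite_visit_times finite_subset)
  finally show ?thesis .
qed

text \<open>Different time assignments give different words, and these are codings over
  \<open>S\<close>: away from the recorded times the orbit avoids \<open>\<Union>S\<close>, since
  each member is visited only once.\<close>

lemma card_visit_times_le_coding_number:
  assumes "finite S" "\<And>Y. Y \<in> S \<Longrightarrow> wandering f Y"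
  shows "card (visit_times f S n) \<le> coding_number f S n"
  unfolding coding_number_def
proof (rule card_inj_on_le[OF _ _ finite_codings[OF assms(1)]])
  show "inj_on (word_of_times S S n) (visit_times f S n)"
  proof (rule inj_onI)
    fix t t' assume t: "t \<in> visit_times f S n" "t' \<in> visit_times f S n"
      and eq: "word_of_times S S n t = word_of_times S S n t'"
    have "t Y = t' Y" if Y: "Y \<in> S" for Y
    proof -
      have *: "inj_on t' S" "t Y < n" "Y \<noteq> {}"
        using t Y by (auto simp: visit_times_def)
      have "word_of_times S S n t' ! t Y = Y"
        using word_of_times_nth[of t S Y n S] t Y eq by (auto simp: visit_times_def)
      \<comment> \<open>A visited \<open>Y\<close> is non-empty. The position \<open>t Y\<close> of
        the other word therefore does not carry the default letter, so it is a value of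
        \<open>t'\<close>.\<close>
      moreover have "Y \<noteq> infty_letter S" using *(3) Y by (auto simp: infty_letter_def)
      ultimately show ?thesis using *(1,2) f_the_inv_into_f[OF *(1), of "t Y"]
        by (auto simp: word_of_times_def split: if_splits)
    qed
    then show "t = t'" using t unfolding visit_times_def
      by (intro PiE_ext[of t S "\<lambda>_. {..<n}" t']) auto
  qed
  show "word_of_times S S n ` visit_times f S n \<subseteq> codings f S n"
  proof
    fix w assume "w \<in> word_of_times S S n ` visit_times f S n"
    then obtain t where t: "t \<in> visit_times f S n" and w: "w = word_of_times S S n t" by blast
    then obtain x where inj: "inj_on t S" and x: "\<And>Y. Y \<in> S \<Longrightarrow> (f ^^ t Y) x \<in> Y"
      and less: "\<And>Y. Y \<in> S \<Longrightarrow> t Y < n"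
      unfolding visit_times_def by blast
    have "w ! i \<in> insert (infty_letter S) S \<and> (f ^^ i) x \<in> w ! i" if i: "i < n" for i
    proof (cases "i \<in> t ` S")
      case True
      then show ?thesis using word_of_times_nth[OF inj] x less w by auto
    next
      case False
      then have "(f ^^ i) x \<in> infty_letter S"
        using wandering_visit_unique[OF assms(2) _ x] by (auto simp: infty_letter_def)
      then show ?thesis using False i w by (simp add: word_of_times_def)
    qed
    then have "is_coding S w (orbit_segment f n x)"
      unfolding coding_iff using w by (simp add: word_of_times_def)
    then show "w \<in> codings f S n" unfolding codings_def by blast
  qed
qed

text \<open>Some \<open>N\<close> bounds the difference of two of the times in every assignment.
  Then \<open>t\<close> is recovered from its restriction to \<open>S - {Y}\<close>, the companion
  \<open>Z\<close> and the difference \<open>d\<close> in \<open>{-N..N}\<close>.\<close>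

lemma card_visit_times_not_mutually_singular:
  assumes "finite S" "\<not> mutually_singular f S"
  obtains C where
    "\<And>n. card (visit_times f S n) \<le> C * (\<Sum>Y\<in>S. card (visit_times f (S - {Y}) n))"
proof -
  obtain N :: int where N: "\<And>x t. (\<forall>Y\<in>S. (f ^^ t Y) x \<in> Y) \<Longrightarrow>
      \<exists>Y\<in>S. \<exists>Z\<in>S. Y \<noteq> Z \<and> \<bar>int (t Y) - int (t Z)\<bar> \<le> N"
    using assms(2) unfolding mutually_singular_def by (meson not_less)
  let ?D = "\<lambda>n. SIGMA Y:S. (S \<times> {-N..N}) \<times> visit_times f (S - {Y}) n"
  \<comment> \<open>The decoding map. The truncation by \<open>nat\<close> is harmless: on the
    triples that encode some \<open>t\<close>, the sum is \<open>t Y\<close>.\<close>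
  let ?g = "\<lambda>(Y, (Z, d), t). t(Y := nat (int (t Z) + d))"
  have "card (visit_times f S n) \<le>
      (card S * card {-N..N}) * (\<Sum>Y\<in>S. card (visit_times f (S - {Y}) n))" for n
  proof -
    have fin: "finite (?D n)"
      using assms(1) by (intro finite_SigmaI finite_cartesian_product finite_visit_times) auto
    have "visit_times f S n \<subseteq> ?g ` ?D n"
    proof
      fix t assume t: "t \<in> visit_times f S n"
      then obtain x where x: "\<forall>Y\<in>S. (f ^^ t Y) x \<in> Y" unfolding visit_times_def by blast
      then obtain Y Z where YZ: "Y \<in> S" "Z \<in> S" "Y \<noteq> Z" "\<bar>int (t Y) - int (t Z)\<bar> \<le> N"
        using N by blast
      let ?t = "restrict t (S - {Y})"
      have "?t \<in> visit_times f (S - {Y}) n"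
        using t x by (auto simp: visit_times_def inj_on_def)
      moreover have "t = ?t(Y := nat (int (?t Z) + (int (t Y) - int (t Z))))"
        using t YZ by (auto simp: visit_times_def PiE_def extensional_def fun_eq_iff)
      ultimately show "t \<in> ?g ` ?D n"
        using YZ by (intro rev_image_eqI[of "(Y, (Z, int (t Y) - int (t Z)), ?t)"]) auto
    qed
    then have "card (visit_times f S n) \<le> card (?D n)" by (rule surj_card_le[OF fin])
    also have "\<dots> = (\<Sum>Y\<in>S. card ((S \<times> {-N..N}) \<times> visit_times f (S - {Y}) n))"
      using assms(1)
      by (intro card_SigmaI) (auto intro!: finite_cartesian_product finite_visit_times)
    also have "\<dots> = (card S * card {-N..N}) * (\<Sum>Y\<in>S. card (visit_times f (S - {Y}) n))"
      unfolding sum_distrib_left card_cartesian_product ..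
    finally show ?thesis .
  qed
  then show thesis by (rule that)
qed

text \<open>Letters are dropped until a mutually singular subfamily remains; the empty family is
  one, so the induction ends. An arbitrary common bound \<open>u\<close> replaces the combination of
  the coding numbers of these subfamilies.\<close>

lemma growth_le_card_visit_times:
  assumes "finite S" "\<And>Y. Y \<in> S \<Longrightarrow> wandering f Y" "is_growth u"
    and "\<And>R. R \<subseteq> S \<Longrightarrow> mutually_singular f R \<Longrightarrow> growth_le (\<lambda>n. real (coding_number f R n)) u"
  shows "growth_le (\<lambda>n. real (card (visit_times f S n))) u"
  using assms
proof (induction S rule: finite_psubset_induct)
  case (psubset S)
  show ?case
  proof (cases "mutually_singular f S")
    case True
    then obtain C where C: "C > 0" "\<forall>n\<ge>1. real (coding_number f S n) \<le> C * u n"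
      using psubset.prems(3)[of S] unfolding growth_le_def by blast
    then show ?thesis unfolding growth_le_def
      using card_visit_times_le_coding_number[OF psubset.hyps psubset.prems(1)]
      by (meson of_nat_le_iff order_trans)
  next
    case False
    then obtain B where
      B: "\<And>n. card (visit_times f S n) \<le> B * (\<Sum>Y\<in>S. card (visit_times f (S - {Y}) n))"
      using card_visit_times_not_mutually_singular[OF psubset.hyps] by blast
    have "growth_le (\<lambda>n. real (card (visit_times f (S - {Y}) n))) u" if "Y \<in> S" for Y
      using that psubset.prems by (intro psubset.IH) auto
    then obtain C where C: "\<And>Y. Y \<in> S \<Longrightarrow> C Y > 0"
      "\<And>Y n. Y \<in> S \<Longrightarrow> n \<ge> 1 \<Longrightarrow> real (card (visit_times f (S - {Y}) n)) \<le> C Y * u n"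
      unfolding growth_le_def by metis
    \<comment> \<open>The summand 1 keeps the constant positive even if \<open>B = 0\<close>; it
      costs nothing because \<open>u n \<ge> 0\<close>.\<close>
    have "real (card (visit_times f S n)) \<le> (real B * sum C S + 1) * u n" if n: "n \<ge> 1" for n
    proof -
      have "real (card (visit_times f S n)) \<le>
          real B * (\<Sum>Y\<in>S. real (card (visit_times f (S - {Y}) n)))"
        using B[of n] by (metis of_nat_le_iff of_nat_mult of_nat_sum)
      also have "\<dots> \<le> real B * (\<Sum>Y\<in>S. C Y * u n)"
        using C n by (intro mult_left_mono sum_mono) auto
      also have "\<dots> \<le> (real B * sum C S + 1) * u n"
        using psubset.prems(2) n by (simp add: is_growth_def sum_distrib_right[symmetric] algebra_simps)
      finally show ?thesis .
    qed
    moreover have "real B * sum C S + 1 > 0"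
      using C(1) by (intro add_nonneg_pos mult_nonneg_nonneg sum_nonneg) (auto intro: less_imp_le)
    ultimately show ?thesis unfolding growth_le_def by blast
  qed
qed

lemma growth_le_coding_number:
  assumes "finite \<F>" "\<And>Y. Y \<in> \<F> \<Longrightarrow> wandering f Y" "is_growth u"
    and "\<And>R. R \<subseteq> \<F> \<Longrightarrow> mutually_singular f R \<Longrightarrow> growth_le (\<lambda>n. real (coding_number f R n)) u"
  shows "growth_le (\<lambda>n. real (coding_number f \<F> n)) u"
proof -
  have "growth_le (\<lambda>n. real (card (visit_times f S n))) u" if "S \<in> Pow \<F>" for S
    using that assms by (intro growth_le_card_visit_times) (auto intro: finite_subset)
  then obtain C where C: "\<And>S. S \<in> Pow \<F> \<Longrightarrow> C S > 0"
    "\<And>S n. S \<in> Pow \<F> \<Longrightarrow> n \<ge> 1 \<Longrightarrow> real (card (visit_times f S n)) \<le> C S * u n"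
    unfolding growth_le_def by metis
  have "real (coding_number f \<F> n) \<le> sum C (Pow \<F>) * u n" if "n \<ge> 1" for n
  proof -
    have "real (coding_number f \<F> n) \<le> (\<Sum>S\<in>Pow \<F>. real (card (visit_times f S n)))"
      using coding_number_le_sum_visit_times[OF assms(1,2)] by (metis of_nat_le_iff of_nat_sum)
    also have "\<dots> \<le> (\<Sum>S\<in>Pow \<F>. C S * u n)" using C that by (intro sum_mono) auto
    finally show ?thesis by (simp add: sum_distrib_right)
  qed
  moreover have "sum C (Pow \<F>) > 0" using C(1) assms(1) by (intro sum_pos) auto
  ultimately show ?thesis unfolding growth_le_def by blast
qed

section \<open>Generalized entropy through codings\<close>

lemma growth_order_coding_number_le_gen_entropy:
  fixes f :: "'a::metric_space \<Rightarrow> 'a"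
  assumes "compact (UNIV :: 'a set)" "continuous_on UNIV f" "\<F> \<in> Sigma_fam f"
  shows "growth_order (coding_number f \<F>) \<le> gen_entropy f"
proof -
  have F: "finite \<F>" "\<Union>\<F> \<inter> nonwandering f = {}" "compact (\<Union>\<F>)"
    using assms(3) by (auto simp: Sigma_fam_def compact_neighborhood_def intro!: compact_Union)
  obtain \<epsilon> where e: "\<epsilon> > 0"
    "growth_le (\<lambda>n. real (coding_number f \<F> n)) (\<lambda>n. real (spanning_number f \<epsilon> n))"
    using coding_number_le_spanning_number[OF assms(1,2) F(1,3,2)] by blast
  then have "growth_order (coding_number f \<F>) \<le> growth_order (spanning_number f \<epsilon>)"
    using is_growth_coding_number[OF F(1)] is_growth_spanning_number[OF assms(1,2)]
    by (simp add: growth_order_le_iff)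
  then show ?thesis unfolding gen_entropy_def using e(1) by (intro SUP_upper2) auto
qed

text \<open>The fine family obtained for \<epsilon> need not be mutually singular, but its mutually
  singular subfamilies lie in \<open>Sigma_small f \<delta>\<close>. An upper bound \<open>u\<close>
  of their coding numbers thus bounds that of the whole family, and with it the spanning
  number.\<close>

lemma gen_entropy_le_SUP_Sigma_small:
  fixes f :: "'a::metric_space \<Rightarrow> 'a"
  assumes "compact (UNIV :: 'a set)" "continuous_on UNIV f" "finite (nonwandering f)" "\<delta> > 0"
  shows "gen_entropy f \<le> (SUP \<F>\<in>Sigma_small f \<delta>. growth_order (coding_number f \<F>))"
  unfolding gen_entropy_def
proof (rule SUP_least, rule embed_le_completionI)
  fix \<epsilon> :: real and x assume "\<epsilon> \<in> {0<..}"
    and x: "(SUP \<F>\<in>Sigma_small f \<delta>. growth_order (coding_number f \<F>)) \<le> embed x"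
  then have e: "\<epsilon> > 0" by simp
  obtain u where u: "x = growth_class u" "is_growth u" by (rule growth_class_cases)
  obtain \<F> where F: "finite \<F>"
    "\<forall>Y\<in>\<F>. Y \<subseteq> - nonwandering f \<and> wandering f Y \<and> compact_neighborhood Y \<and> diameter Y < \<delta>"
    and g: "growth_le (\<lambda>n. real (spanning_number f \<epsilon> n)) (\<lambda>n. real (coding_number f \<F> n))"
    using spanning_number_le_coding_number[OF assms(1-3) e assms(4)] by blast
  have "growth_le (\<lambda>n. real (coding_number f R n)) u" if "R \<subseteq> \<F>" "mutually_singular f R" for R
  proof -
    have R: "finite R" using that(1) F(1) by (rule finite_subset)
    then have "R \<in> Sigma_small f \<delta>"
      using F that by (auto simp: Sigma_small_def Sigma_fam_def)
    then have "growth_order (coding_number f R) \<le> embed x" using x by (simp add: SUP_le_iff)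
    then show ?thesis
      using u is_growth_coding_number[OF R] by (simp add: embed_le_iff growth_class_le_iff)
  qed
  then have "growth_le (\<lambda>n. real (coding_number f \<F> n)) u"
    using growth_le_coding_number[OF F(1) _ u(2)] F(2) by blast
  then show "growth_class (\<lambda>n. real (spanning_number f \<epsilon> n)) \<le> x"
    using growth_le_trans[OF g] u is_growth_spanning_number[OF assms(1,2) e]
    by (simp add: growth_class_le_iff)
qed

theorem theorem2:
  fixes f :: "'a::metric_space \<Rightarrow> 'a"
  assumes "compact (UNIV :: 'a set)"
    and "\<exists>g. homeomorphism UNIV UNIV f g"
    and "finite (nonwandering f)"
  shows "gen_entropy f = (SUP \<F>\<in>Sigma_fam f. growth_order (coding_number f \<F>)) \<and>
    (\<forall>\<delta>>0. gen_entropy f = (SUP \<F>\<in>Sigma_small f \<delta>. growth_order (coding_number f \<F>)))"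
proof -
  let ?c = "\<lambda>\<F>. growth_order (coding_number f \<F>)"
  have cont: "continuous_on UNIV f" using assms(2) unfolding homeomorphism_def by blast
  have upper: "(SUP \<F>\<in>Sigma_fam f. ?c \<F>) \<le> gen_entropy f"
    by (intro SUP_least growth_order_coding_number_le_gen_entropy assms(1) cont)
  have small: "gen_entropy f \<le> (SUP \<F>\<in>Sigma_small f \<delta>. ?c \<F>)" if "\<delta> > 0" for \<delta>
    using gen_entropy_le_SUP_Sigma_small[OF assms(1) cont assms(3) that] .
  have mid: "(SUP \<F>\<in>Sigma_small f \<delta>. ?c \<F>) \<le> (SUP \<F>\<in>Sigma_fam f. ?c \<F>)" for \<delta>
    by (rule SUP_subset_mono) (auto simp: Sigma_small_def)
  \<comment> \<open>Any positive \<delta> serves; \<delta> = 1 is taken.\<close>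
  have "gen_entropy f \<le> (SUP \<F>\<in>Sigma_fam f. ?c \<F>)"
    using order_trans[OF small mid] zero_less_one by blast
  then show ?thesis
    using upper small mid by (intro conjI allI impI order_antisym) (auto intro: order_trans[OF mid upper])
qed

end
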